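(* Let $\mathcal{H}$ be a complex Hilbert space and let $T\in\mathcal{B}(\mathcal{H})$ have closed range. Then the following are equivalent: (1) $T$ is EP. (2) There exists an isomorphism $V\in\mathcal{B}(\mathcal{H})$ such that $T^*T=TV^*VT^*$. (3) There exists an injective $N\in\mathcal{B}(\mathcal{H})$ such that $T^*T=TN^*NT^*$. (4) There exist $S_1,S_2\in\mathcal{B}(\mathcal{H})$ such that $T^*T=TS_1T^*$ and $TT^*=T^*S_2T$.
   Context: $\mathcal{B}(\mathcal{H})$ denotes the bounded linear operators on $\mathcal{H}$. $\mathcal{N}(T)$ is the kernel of $T$ and $T^*$ its adjoint. An operator $T\in\mathcal{B}(\mathcal{H})$ with closed range is called EP if $\mathcal{N}(T)=\mathcal{N}(T^* )$. A bounded operator is an isomorphism if it is injective and onto (not necessarily isometric). *)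

theory Defs
  imports "HOL-Analysis.Analysis"
begin

text \<open>
  The norm, metric and real scalar multiplication are inherited from the library's real normed
  spaces; the axioms tie them to the complex structure and to the inner product. The inner
  product is linear in its first argument.
\<close>

class complex_inner = real_normed_vector +
  fixes scaleC :: "complex \<Rightarrow> 'a \<Rightarrow> 'a"  (infixr \<open>*\<^sub>C\<close> 75)
    and cinner :: "'a \<Rightarrow> 'a \<Rightarrow> complex"
  assumes scaleC_add_right: "a *\<^sub>C (x + y) = a *\<^sub>C x + a *\<^sub>C y"
    and scaleC_add_left: "(a + b) *\<^sub>C x = a *\<^sub>C x + b *\<^sub>C x"
    and scaleC_scaleC: "a *\<^sub>C (b *\<^sub>C x) = (a * b) *\<^sub>C x"
    and scaleR_scaleC: "r *\<^sub>R x = complex_of_real r *\<^sub>C x"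
    and cinner_commute: "cinner x y = cnj (cinner y x)"
    and cinner_add_left: "cinner (x + y) z = cinner x z + cinner y z"
    and cinner_scaleC_left: "cinner (a *\<^sub>C x) y = a * cinner x y"
    and cinner_self_nonneg: "0 \<le> Re (cinner x x)"
    and cinner_self_eq_zero: "cinner x x = 0 \<longleftrightarrow> x = 0"
    and norm_eq_sqrt_cinner: "norm x = sqrt (Re (cinner x x))"

class chilbert_space = complex_inner + complete_space

instantiation complex :: chilbert_space
begin
definition scaleC_complex :: "complex \<Rightarrow> complex \<Rightarrow> complex"
  where "scaleC_complex a x = a * x"
definition cinner_complex :: "complex \<Rightarrow> complex \<Rightarrow> complex"
  where "cinner_complex x y = x * cnj y"
instance
  by standard
    (auto simp: scaleC_complex_def cinner_complex_def algebra_simps scaleR_conv_of_real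
      cmod_def power2_eq_square)
end

definition bounded_clinear :: "('a::complex_inner \<Rightarrow> 'a) \<Rightarrow> bool"
  where "bounded_clinear T \<longleftrightarrow> bounded_linear T \<and> (\<forall>a x. T (a *\<^sub>C x) = a *\<^sub>C T x)"

text \<open>
  On a Hilbert space the function described here exists for every bounded operator by the Riesz
  representation theorem; it is unique because the inner product is definite.
\<close>

definition cadjoint :: "('a::complex_inner \<Rightarrow> 'a) \<Rightarrow> 'a \<Rightarrow> 'a"  (\<open>_\<^sup>\<star>\<close> [1000] 1000)
  where "T\<^sup>\<star> = (THE S. \<forall>x y. cinner (T x) y = cinner x (S y))"

definition kernel :: "('a::complex_inner \<Rightarrow> 'a) \<Rightarrow> 'a set"
  where "kernel T = {x. T x = 0}"

definition EP :: "('a::complex_inner \<Rightarrow> 'a) \<Rightarrow> bool"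
  where "EP T \<longleftrightarrow> bounded_clinear T \<and> closed (range T) \<and> kernel T = kernel (T\<^sup>\<star>)"

definition isomorphism :: "('a::complex_inner \<Rightarrow> 'a) \<Rightarrow> bool"
  where "isomorphism V \<longleftrightarrow> bounded_clinear V \<and> inj V \<and> surj V"

end

theory Submission
  imports Defs
begin

text \<open>
  A factorisation \<open>T\<^sup>\<star> \<circ> T = T \<circ> S \<circ> T\<^sup>\<star>\<close> forces \<open>kernel (T\<^sup>\<star>) \<subseteq> kernel T\<close>, because
  \<open>kernel (T\<^sup>\<star> \<circ> T) = kernel T\<close>. If \<open>S = N\<^sup>\<star> \<circ> N\<close> with \<open>N\<close> injective, then
  \<open>T \<circ> N\<^sup>\<star> \<circ> N \<circ> T\<^sup>\<star> = (N \<circ> T\<^sup>\<star>)\<^sup>\<star> \<circ> (N \<circ> T\<^sup>\<star>)\<close> has the kernel of \<open>T\<^sup>\<star>\<close>, so that both kernels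
  coincide. The second equation in the last condition is the first one with \<open>T\<close> and \<open>T\<^sup>\<star>\<close>
  exchanged, and gives the other inclusion there. Hence each of the three conditions implies that
  \<open>T\<close> is EP.

  Conversely, let \<open>T\<close> be EP. The range \<open>M\<close> of \<open>T\<close> is closed and its orthogonal complement is the
  common kernel of \<open>T\<close> and \<open>T\<^sup>\<star>\<close>. With \<open>P\<close> the orthogonal projection onto \<open>M\<close>, the map
  \<open>B = T + (1 - P)\<close> is a bijection with adjoint \<open>B\<^sup>\<star> = T\<^sup>\<star> + (1 - P)\<close>, which is then bijective too
  (\<open>adjoint_pair_bij\<close>). Since \<open>B\<^sup>\<star> \<circ> P = T\<^sup>\<star>\<close> and \<open>B \<circ> P = T\<close>, the map \<open>V = B \<circ> (B\<^sup>\<star>)\<^sup>-\<^sup>1\<close>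
  is a bijection satisfying \<open>V \<circ> T\<^sup>\<star> = T\<close> (\<open>EP_imp_isomorphism\<close>). Taking adjoints gives
  \<open>T \<circ> V\<^sup>\<star> = T\<^sup>\<star>\<close>, hence \<open>T \<circ> V\<^sup>\<star> \<circ> V \<circ> T\<^sup>\<star> = T\<^sup>\<star> \<circ> T\<close>; the inverse of \<open>V\<close> sends \<open>T\<close> to
  \<open>T\<^sup>\<star>\<close> and gives \<open>S\<^sub>2\<close> in the same way.

  The functional analysis is organised around pairs of everywhere defined mutually adjoint maps.
  By uniform boundedness such maps are automatically bounded (\<open>adjoint_pair_bounded_clinear\<close>), and
  the adjoint of a surjection is bounded below. This takes the place of the open mapping and closed
  range theorems: \<open>V\<close> and its inverse have adjoints, and are therefore bounded.
\<close>

section \<open>Complex inner products\<close>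

lemma cinner_add_right: "cinner x (y + z) = cinner x y + cinner x z"
  by (metis cinner_add_left cinner_commute complex_cnj_add)

lemma cinner_scaleC_right: "cinner x (a *\<^sub>C y) = cnj a * cinner x y"
  by (metis cinner_scaleC_left cinner_commute complex_cnj_mult)

lemma scaleC_minus_one: "(-1) *\<^sub>C x = - x" for x :: "'a::complex_inner"
  using scaleR_scaleC[of "-1" x] by simp

lemma cinner_minus_left: "cinner (- x) y = - cinner x y"
  using cinner_scaleC_left[of "-1" x y] by (simp add: scaleC_minus_one)

lemma cinner_minus_right: "cinner x (- y) = - cinner x y"
  using cinner_scaleC_right[of x "-1" y] by (simp add: scaleC_minus_one)

lemma cinner_diff_left: "cinner (x - y) z = cinner x z - cinner y z"
  using cinner_add_left[of x "- y" z] by (simp add: cinner_minus_left)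

lemma cinner_diff_right: "cinner x (y - z) = cinner x y - cinner x z"
  using cinner_add_right[of x y "- z"] by (simp add: cinner_minus_right)

lemma cinner_zero_left [simp]: "cinner 0 y = 0"
  using cinner_diff_left[of 0 0 y] by simp

lemma cinner_zero_right [simp]: "cinner x 0 = 0"
  using cinner_diff_right[of x 0 0] by simp

lemmas cinner_simps = cinner_add_left cinner_add_right cinner_diff_left cinner_diff_right
  cinner_minus_left cinner_minus_right cinner_scaleC_left cinner_scaleC_right

lemma cinner_self: "cinner x x = of_real ((norm x)\<^sup>2)"
proof -
  have "Im (cinner x x) = 0"
    using cinner_commute[of x x] by (simp add: complex_eq_iff)
  then show ?thesis
    by (simp add: complex_eq_iff norm_eq_sqrt_cinner cinner_self_nonneg)
qed

lemma cinner_eqI: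
  assumes "\<And>z. cinner x z = cinner y z"
  shows "x = y"
proof -
  have "cinner (x - y) (x - y) = 0"
    using assms[of "x - y"] by (simp add: cinner_diff_left)
  then show ?thesis
    by (simp add: cinner_self_eq_zero)
qed

lemma cinner_eqI':
  assumes "\<And>z. cinner z x = cinner z y"
  shows "x = y"
  by (rule cinner_eqI) (metis assms cinner_commute)

lemma norm_add_squared: "(norm (x + y))\<^sup>2 = (norm x)\<^sup>2 + (norm y)\<^sup>2 + 2 * Re (cinner x y)"
  for x y :: "'a::complex_inner"
proof -
  have "complex_of_real ((norm (x + y))\<^sup>2) = cinner x x + cinner y y + (cinner x y + cnj (cinner x y))"
    unfolding cinner_self[symmetric] by (simp add: cinner_simps cinner_commute[of y x])
  also have "\<dots> = of_real ((norm x)\<^sup>2 + (norm y)\<^sup>2 + 2 * Re (cinner x y))"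
    by (simp add: cinner_self complex_eq_iff)
  finally show ?thesis
    by (simp only: of_real_eq_iff)
qed

lemma parallelogram_law:
  "(norm (x + y))\<^sup>2 + (norm (x - y))\<^sup>2 = 2 * (norm x)\<^sup>2 + 2 * (norm y)\<^sup>2"
  for x y :: "'a::complex_inner"
  using norm_add_squared[of x y] norm_add_squared[of x "- y"] by (simp add: cinner_minus_right)

text \<open>
  The expansion of \<open>\<parallel>x - c y\<parallel>\<^sup>2\<close> at its minimum over \<open>c\<close>; it yields both the Cauchy-Schwarz
  inequality and the orthogonality of the residual in the projection theorem.
\<close>

lemma norm_diff_scaleC_squared:
  fixes x y :: "'a::complex_inner"
  assumes "y \<noteq> 0"
  shows "(norm (x - (cinner x y / of_real ((norm y)\<^sup>2)) *\<^sub>C y))\<^sup>2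
    = (norm x)\<^sup>2 - (cmod (cinner x y))\<^sup>2 / (norm y)\<^sup>2"
proof -
  define c where "c = cinner x y / of_real ((norm y)\<^sup>2)"
  have y: "complex_of_real ((norm y)\<^sup>2) \<noteq> 0"
    using assms by simp
  have "complex_of_real ((norm (x - c *\<^sub>C y))\<^sup>2)
      = cinner x x - cnj c * cinner x y - c * (cinner y x - cnj c * cinner y y)"
    unfolding cinner_self[symmetric] by (simp add: cinner_simps algebra_simps)
  also have "cnj c * cinner y y = cinner y x"
    using y by (simp add: c_def cinner_self cinner_commute[of y x])
  also have "cnj c * cinner x y = of_real ((cmod (cinner x y))\<^sup>2 / (norm y)\<^sup>2)"
    using complex_norm_square[of "cinner x y"] by (simp add: c_def mult.commute)
  finally have "complex_of_real ((norm (x - c *\<^sub>C y))\<^sup>2)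
      = of_real ((norm x)\<^sup>2 - (cmod (cinner x y))\<^sup>2 / (norm y)\<^sup>2)"
    by (simp add: cinner_self)
  then show ?thesis
    by (simp only: of_real_eq_iff c_def)
qed

lemma Cauchy_Schwarz: "cmod (cinner x y) \<le> norm x * norm y"
proof (cases "y = 0")
  case False
  have "0 \<le> (norm x)\<^sup>2 - (cmod (cinner x y))\<^sup>2 / (norm y)\<^sup>2"
    unfolding norm_diff_scaleC_squared[OF False, symmetric] by simp
  then have "(cmod (cinner x y))\<^sup>2 \<le> (norm x * norm y)\<^sup>2"
    using False by (simp add: divide_simps power_mult_distrib)
  then show ?thesis
    by (rule power2_le_imp_le) simp
qed simp

section \<open>Orthogonal projection and Riesz representation\<close>

text \<open>Complex linear subspaces, not assumed to be closed.\<close>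

definition csubspace :: "'a::complex_inner set \<Rightarrow> bool"
  where "csubspace M \<longleftrightarrow> 0 \<in> M \<and> (\<forall>x\<in>M. \<forall>y\<in>M. x + y \<in> M) \<and> (\<forall>a. \<forall>x\<in>M. a *\<^sub>C x \<in> M)"

lemma csubspace_diff: "csubspace M \<Longrightarrow> x \<in> M \<Longrightarrow> y \<in> M \<Longrightarrow> x - y \<in> M"
  unfolding csubspace_def by (metis scaleC_minus_one uminus_add_conv_diff add.commute)

text \<open>A minimising sequence for the distance is Cauchy by the parallelogram law.\<close>

lemma nearest_point_exists:
  fixes M :: "'a::chilbert_space set"
  assumes M: "csubspace M" "closed M"
  shows "\<exists>m\<in>M. \<forall>z\<in>M. norm (x - m) \<le> norm (x - z)"
proof -
  define d where "d = infdist x M"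
  have ne: "M \<noteq> {}"
    using M by (auto simp: csubspace_def)
  have d0: "0 \<le> d"
    by (simp add: d_def infdist_nonneg)
  have d_le: "d \<le> norm (x - z)" if "z \<in> M" for z
    using infdist_le[OF that, of x] by (simp add: d_def dist_norm)
  have "\<exists>m\<in>M. (norm (x - m))\<^sup>2 < d\<^sup>2 + 1 / real (Suc n)" for n
  proof -
    have "d < sqrt (d\<^sup>2 + 1 / real (Suc n))"
      using d0 by (intro real_less_rsqrt) simp
    moreover have "d = (INF a\<in>M. dist x a)"
      by (simp add: d_def infdist_notempty ne)
    ultimately obtain m where m: "m \<in> M" "norm (x - m) < sqrt (d\<^sup>2 + 1 / real (Suc n))"
      using cINF_less_iff[OF ne bdd_below_image_dist, of x] by (auto simp: dist_norm)
    have "(norm (x - m))\<^sup>2 < (sqrt (d\<^sup>2 + 1 / real (Suc n)))\<^sup>2"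
      using m(2) by (intro power_strict_mono) auto
    then show ?thesis
      using m(1) by auto
  qed
  then obtain u where u: "\<And>n. u n \<in> M" "\<And>n. (norm (x - u n))\<^sup>2 < d\<^sup>2 + 1 / real (Suc n)"
    by metis
  \<comment> \<open>The midpoint of \<open>u i\<close> and \<open>u j\<close> lies in \<open>M\<close>, hence at distance at least \<open>d\<close> from \<open>x\<close>.\<close>
  have gap: "(norm (u i - u j))\<^sup>2 \<le> 2 / real (Suc i) + 2 / real (Suc j)" for i j
  proof -
    have mid: "(1/2) *\<^sub>R (u i + u j) \<in> M"
      using M(1) u(1) by (simp add: csubspace_def scaleR_scaleC)
    have "(x - u j) + (x - u i) = 2 *\<^sub>R (x - (1/2) *\<^sub>R (u i + u j))"
      by (simp add: algebra_simps scaleR_2)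
    then have "norm ((x - u j) + (x - u i)) = 2 * norm (x - (1/2) *\<^sub>R (u i + u j))"
      by simp
    then have "2 * d \<le> norm ((x - u j) + (x - u i))"
      using d_le[OF mid] by linarith
    then have "(2 * d)\<^sup>2 \<le> (norm ((x - u j) + (x - u i)))\<^sup>2"
      using d0 by (intro power_mono) auto
    moreover have "(x - u j) - (x - u i) = u i - u j"
      by simp
    ultimately show ?thesis
      using parallelogram_law[of "x - u j" "x - u i"] u(2)[of i] u(2)[of j]
      by (simp add: power_mult_distrib)
  qed
  have "Cauchy u"
  proof (rule CauchyI)
    fix e :: real
    assume e: "0 < e"
    obtain k where k: "4 / e\<^sup>2 < real k"
      using reals_Archimedean2 by blast
    have "norm (u i - u j) < e" if "k \<le> i" "k \<le> j" for i j
    proof -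
      have "2 / real (Suc n) < e\<^sup>2 / 2" if "k \<le> n" for n
      proof -
        have "4 / e\<^sup>2 < real (Suc n)"
          using k that by linarith
        then show ?thesis
          using e by (simp add: field_simps)
      qed
      then have "(norm (u i - u j))\<^sup>2 < e\<^sup>2"
        using gap[of i j] that by (smt (verit) field_sum_of_halves)
      then show ?thesis
        using e by (simp add: power_less_imp_less_base)
    qed
    then show "\<exists>k. \<forall>i\<ge>k. \<forall>j\<ge>k. norm (u i - u j) < e"
      by blast
  qed
  then obtain m where m: "u \<longlonglongrightarrow> m"
    by (auto simp: Cauchy_convergent_iff convergent_def)
  have "m \<in> M"
    using closed_sequentially[OF M(2) u(1) m] .
  have "(\<lambda>n. (norm (x - u n))\<^sup>2) \<longlonglongrightarrow> (norm (x - m))\<^sup>2"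
    by (intro tendsto_intros m)
  moreover have "(\<lambda>n. d\<^sup>2 + 1 / real (Suc n)) \<longlonglongrightarrow> d\<^sup>2 + 0"
    by (intro tendsto_add tendsto_const LIMSEQ_Suc lim_1_over_n)
  ultimately have "(norm (x - m))\<^sup>2 \<le> d\<^sup>2 + 0"
    by (rule LIMSEQ_le) (intro exI allI impI less_imp_le u(2))
  then have "norm (x - m) \<le> d"
    by (intro power2_le_imp_le[OF _ d0]) simp
  then show ?thesis
    using \<open>m \<in> M\<close> d_le by (blast intro: order_trans)
qed

lemma orthogonal_decomposition:
  fixes M :: "'a::chilbert_space set"
  assumes M: "csubspace M" "closed M"
  shows "\<exists>m\<in>M. \<forall>z\<in>M. cinner (x - m) z = 0"
proof -
  obtain m where m: "m \<in> M" "\<And>z. z \<in> M \<Longrightarrow> norm (x - m) \<le> norm (x - z)"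
    using nearest_point_exists[OF M] by blast
  have "cinner (x - m) z = 0" if z: "z \<in> M" for z
  proof (cases "z = 0")
    case False
    define c where "c = cinner (x - m) z / of_real ((norm z)\<^sup>2)"
    have "m + c *\<^sub>C z \<in> M"
      using M(1) m(1) z by (simp add: csubspace_def)
    then have "norm (x - m) \<le> norm (x - m - c *\<^sub>C z)"
      using m(2) by (simp add: diff_diff_eq)
    then have "(norm (x - m))\<^sup>2 \<le> (norm (x - m - c *\<^sub>C z))\<^sup>2"
      by (simp add: power_mono)
    then have "(cmod (cinner (x - m) z))\<^sup>2 / (norm z)\<^sup>2 \<le> 0"
      unfolding c_def norm_diff_scaleC_squared[OF False] by simp
    then show ?thesis
      using False by (simp add: divide_le_0_iff)
  qed simp
  then show ?thesis
    using m(1) by blast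
qed

lemma Riesz_representation:
  fixes f :: "'a::chilbert_space \<Rightarrow> complex"
  assumes add: "\<And>x y. f (x + y) = f x + f y"
    and scale: "\<And>a x. f (a *\<^sub>C x) = a * f x"
    and bound: "\<And>x. cmod (f x) \<le> norm x * K"
  shows "\<exists>w. \<forall>x. f x = cinner x w"
proof (cases "\<forall>x. f x = 0")
  case True
  then show ?thesis
    by (intro exI[of _ 0]) simp
next
  case False
  have "bounded_linear f"
    by (rule bounded_linear_intro[of _ K])
      (simp_all add: add scale bound scaleR_scaleC scaleC_complex_def)
  then have "continuous_on UNIV f"
    by (rule linear_continuous_on)
  then have closed: "closed {x. f x = 0}"
    by (intro closed_Collect_eq) auto
  have f0: "f 0 = 0"
    using add[of 0 0] by simp
  have fminus: "f (x - y) = f x - f y" for x y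
    using add[of "x - y" y] by simp
  have sub: "csubspace {x. f x = 0}"
    by (simp add: csubspace_def f0 add scale)
  obtain x0 where x0: "f x0 \<noteq> 0"
    using False by blast
  obtain m where m: "f m = 0" "\<And>z. f z = 0 \<Longrightarrow> cinner (x0 - m) z = 0"
    using orthogonal_decomposition[OF sub closed, of x0] by auto
  \<comment> \<open>A vector orthogonal to the kernel of \<open>f\<close>; a multiple of it represents \<open>f\<close>.\<close>
  define w where "w = x0 - m"
  have fw: "f w \<noteq> 0"
    using x0 m(1) by (simp add: w_def fminus)
  then have w0: "w \<noteq> 0"
    using f0 by auto
  have "f x = cinner x ((cnj (f w) / of_real ((norm w)\<^sup>2)) *\<^sub>C w)" for x
  proof -
    have "f (x - (f x / f w) *\<^sub>C w) = 0"
      using fw by (simp add: fminus scale)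
    then have "cinner w (x - (f x / f w) *\<^sub>C w) = 0"
      unfolding w_def by (rule m(2))
    then have "cinner (x - (f x / f w) *\<^sub>C w) w = 0"
      by (metis cinner_commute complex_cnj_zero)
    then have "cinner x w = f x / f w * of_real ((norm w)\<^sup>2)"
      by (simp add: cinner_simps cinner_self)
    then show ?thesis
      using fw w0 by (simp add: cinner_simps)
  qed
  then show ?thesis
    by blast
qed

section \<open>Pairs of mutually adjoint maps\<close>

text \<open>
  Two maps, each the adjoint of the other. They are arbitrary functions: linearity is a
  consequence, and on a Hilbert space so is boundedness.
\<close>

definition adjoint_pair :: "('a::complex_inner \<Rightarrow> 'a) \<Rightarrow> ('a \<Rightarrow> 'a) \<Rightarrow> bool"
  where "adjoint_pair S T \<longleftrightarrow> (\<forall>x y. cinner (S x) y = cinner x (T y))"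

lemma adjoint_pairD: "adjoint_pair S T \<Longrightarrow> cinner (S x) y = cinner x (T y)"
  by (simp add: adjoint_pair_def)

lemma adjoint_pair_sym: "adjoint_pair S T \<Longrightarrow> adjoint_pair T S"
  unfolding adjoint_pair_def by (metis cinner_commute)

lemma adjoint_pair_comp:
  "adjoint_pair S T \<Longrightarrow> adjoint_pair S' T' \<Longrightarrow> adjoint_pair (S \<circ> S') (T' \<circ> T)"
  by (simp add: adjoint_pair_def)

lemma adjoint_pair_inv:
  assumes "adjoint_pair S T" "bij S" "bij T"
  shows "adjoint_pair (inv S) (inv T)"
  unfolding adjoint_pair_def
proof (intro allI)
  fix x y
  have "cinner (inv S x) (T (inv T y)) = cinner (S (inv S x)) (inv T y)"
    using assms(1) by (simp add: adjoint_pair_def)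
  then show "cinner (inv S x) y = cinner x (inv T y)"
    using assms(2,3) by (simp add: bij_is_surj surj_f_inv_f)
qed

lemma adjoint_pair_unique:
  assumes "adjoint_pair S T" "adjoint_pair S T'"
  shows "T = T'"
proof
  fix y
  show "T y = T' y"
    by (rule cinner_eqI')
      (simp only: adjoint_pairD[OF assms(1), symmetric] adjoint_pairD[OF assms(2), symmetric])
qed

lemma cadjoint_eqI:
  assumes "adjoint_pair S T"
  shows "S\<^sup>\<star> = T"
  unfolding cadjoint_def
proof (rule the_equality)
  show "\<forall>x y. cinner (S x) y = cinner x (T y)"
    using assms by (simp add: adjoint_pair_def)
  show "U = T" if "\<forall>x y. cinner (S x) y = cinner x (U y)" for U
    using adjoint_pair_unique[OF assms, of U] that by (simp add: adjoint_pair_def)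
qed

lemma adjoint_pair_cadjoint:
  fixes T :: "'a::chilbert_space \<Rightarrow> 'a"
  assumes "bounded_clinear T"
  shows "adjoint_pair T (T\<^sup>\<star>)"
proof -
  have T: "bounded_linear T" "\<And>a x. T (a *\<^sub>C x) = a *\<^sub>C T x"
    using assms by (auto simp: bounded_clinear_def)
  obtain K where K: "\<And>x. norm (T x) \<le> norm x * K"
    using bounded_linear.bounded[OF T(1)] by blast
  have "\<exists>w. \<forall>x. cinner (T x) y = cinner x w" for y
  proof (rule Riesz_representation)
    show "cmod (cinner (T x) y) \<le> norm x * (K * norm y)" for x
    proof -
      have "cmod (cinner (T x) y) \<le> norm (T x) * norm y"
        by (rule Cauchy_Schwarz)
      also have "\<dots> \<le> norm x * K * norm y"
        by (intro mult_right_mono K) simp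
      finally show ?thesis
        by (simp add: mult.assoc)
    qed
  qed (use T in \<open>simp_all add: linear_simps cinner_simps\<close>)
  then obtain S where "adjoint_pair T S"
    unfolding adjoint_pair_def by metis
  then show ?thesis
    by (simp add: cadjoint_eqI)
qed

lemma adjoint_pair_linear:
  assumes "adjoint_pair S T"
  shows adjoint_pair_add: "S (x + y) = S x + S y"
    and adjoint_pair_diff: "S (x - y) = S x - S y"
    and adjoint_pair_scaleC: "S (a *\<^sub>C x) = a *\<^sub>C S x"
    and adjoint_pair_zero: "S 0 = 0"
    and adjoint_pair_scaleR: "S (r *\<^sub>R x) = r *\<^sub>R S x"
  by (rule cinner_eqI; simp add: adjoint_pairD[OF assms] cinner_simps scaleR_scaleC)+

lemma csubspace_range:
  assumes "adjoint_pair S T"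
  shows "csubspace (range S)"
  unfolding csubspace_def
proof (intro conjI ballI allI)
  show "0 \<in> range S"
    by (metis adjoint_pair_zero[OF assms] rangeI)
  show "x + y \<in> range S" if "x \<in> range S" "y \<in> range S" for x y
    using that by (auto simp flip: adjoint_pair_add[OF assms])
  show "a *\<^sub>C x \<in> range S" if "x \<in> range S" for a x
    using that by (auto simp flip: adjoint_pair_scaleC[OF assms])
qed

section \<open>Uniform boundedness\<close>

text \<open>
  Uniform boundedness principle for the functionals \<open>\<lambda>z. cinner z y\<close> with \<open>y \<in> Y\<close>.
\<close>

lemma weakly_bounded_imp_bounded:
  fixes Y :: "'a::chilbert_space set"
  assumes "\<And>z. \<exists>K. \<forall>y\<in>Y. cmod (cinner z y) \<le> K"
  shows "\<exists>K. \<forall>y\<in>Y. norm y \<le> K"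
proof -
  define A where "A n = (\<Inter>y\<in>Y. {z. cmod (cinner z y) \<le> real n})" for n :: nat
  have cont: "continuous_on UNIV (\<lambda>z. cinner z y)" for y :: 'a
    by (rule linear_continuous_on, rule bounded_linear_intro[of _ "norm y"])
      (simp_all add: cinner_simps Cauchy_Schwarz scaleR_scaleC scaleC_complex_def)
  have closed: "closed (A n)" for n
    unfolding A_def by (intro closed_INT ballI closed_Collect_le continuous_intros cont)
  have "z \<in> \<Union>(range A)" for z
  proof -
    obtain K where K: "\<forall>y\<in>Y. cmod (cinner z y) \<le> K"
      using assms by blast
    obtain n where "K \<le> real n"
      using real_arch_simple by blast
    then have "z \<in> A n"
      using K by (auto simp: A_def)
    then show ?thesis
      by blast
  qed
  then have union: "\<Union>(range A) = UNIV"
    by blast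
  \<comment> \<open>The closed sets \<open>A n\<close> cover the space, so one of them has interior points by Baire.\<close>
  have "\<exists>n. interior (A n) \<noteq> {}"
  proof (rule ccontr)
    assume "\<nexists>n. interior (A n) \<noteq> {}"
    then have "(euclidean :: 'a topology) interior_of \<Union>(range A) = {}"
      using closed
      by (intro Baire_category_alt disjI1 completely_metrizable_space_euclidean) auto
    then show False
      by (simp add: union)
  qed
  then obtain n z r where r: "0 < r" "ball z r \<subseteq> A n"
    using mem_interior by blast
  have "norm y \<le> 4 * real n / r" if y: "y \<in> Y" for y
  proof (cases "y = 0")
    case False
    define h where "h = (r / (2 * norm y)) *\<^sub>R y"
    have "norm h = r / 2"
      using False r(1) by (simp add: h_def)
    then have "z + h \<in> A n" "z \<in> A n"
      using r by (auto simp: dist_norm)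
    then have "cmod (cinner (z + h) y) \<le> real n" "cmod (cinner z y) \<le> real n"
      using y by (auto simp: A_def)
    then have "cmod (cinner (z + h) y - cinner z y) \<le> 2 * real n"
      using norm_triangle_ineq4[of "cinner (z + h) y" "cinner z y"] by linarith
    moreover have "cinner (z + h) y - cinner z y = of_real (r / 2 * norm y)"
      using False by (simp add: cinner_simps h_def scaleR_scaleC cinner_self power2_eq_square)
    ultimately have "r / 2 * norm y \<le> 2 * real n"
      using r(1) by (simp add: norm_mult)
    then show ?thesis
      using r(1) by (simp add: field_simps)
  qed (use r in simp)
  then show ?thesis
    by blast
qed

text \<open>The Hellinger-Toeplitz theorem.\<close>

lemma adjoint_pair_bounded_clinear:
  fixes S :: "'a::chilbert_space \<Rightarrow> 'a"
  assumes "adjoint_pair S T"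
  shows "bounded_clinear S"
proof -
  note lin = adjoint_pair_linear[OF assms]
  have "\<exists>K. \<forall>y\<in>S ` cball 0 1. norm y \<le> K"
  proof (rule weakly_bounded_imp_bounded)
    fix z
    have "cmod (cinner z (S x)) \<le> norm (T z)" if "norm x \<le> 1" for x
    proof -
      have "cmod (cinner z (S x)) \<le> norm (T z) * norm x"
        using Cauchy_Schwarz[of "T z" x] adjoint_pairD[OF adjoint_pair_sym[OF assms]] by simp
      also have "\<dots> \<le> norm (T z)"
        using that by (simp add: mult_left_le)
      finally show ?thesis .
    qed
    then show "\<exists>K. \<forall>y\<in>S ` cball 0 1. cmod (cinner z y) \<le> K"
      by (intro exI[of _ "norm (T z)"]) auto
  qed
  then obtain K where "\<forall>y\<in>S ` cball 0 1. norm y \<le> K"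
    by blast
  then have K: "norm (S x) \<le> K" if "norm x \<le> 1" for x
    using that by simp
  have "norm (S x) \<le> norm x * K" for x
  proof (cases "x = 0")
    case False
    have "norm (S (inverse (norm x) *\<^sub>R x)) \<le> K"
      by (rule K) (use False in simp)
    then show ?thesis
      using False by (simp add: adjoint_pair_scaleR[OF assms] field_simps)
  qed (simp add: lin)
  then have "bounded_linear S"
    by (intro bounded_linear_intro) (simp_all add: lin)
  then show ?thesis
    by (simp add: bounded_clinear_def lin)
qed

text \<open>
  Surjectivity of \<open>S\<close> makes \<open>T\<close> bounded below, by uniform boundedness; so \<open>T\<close> is injective and its
  range is closed. A vector orthogonal to this range lies in the kernel of \<open>S\<close>, hence vanishes.
\<close>

lemma adjoint_pair_bij:
  fixes S :: "'a::chilbert_space \<Rightarrow> 'a"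
  assumes ST: "adjoint_pair S T" and S: "bij S"
  shows "bij T"
proof -
  note lin = adjoint_pair_linear[OF adjoint_pair_sym[OF ST]]
  have T0: "y = 0" if "T y = 0" for y
  proof -
    obtain x where "S x = y"
      using S by (metis bij_pointE)
    then have "cinner y y = 0"
      using adjoint_pairD[OF ST, of x y] that by simp
    then show ?thesis
      by (simp add: cinner_self_eq_zero)
  qed
  have inj: "inj T"
    by (rule injI) (metis T0 lin(2) eq_iff_diff_eq_0)
  \<comment> \<open>Writing \<open>z = S x\<close> bounds \<open>\<bar>\<langle>z, y\<rangle>\<bar> = \<bar>\<langle>x, T y\<rangle>\<bar>\<close> for all \<open>y\<close> in this set.\<close>
  have "\<exists>K. \<forall>y\<in>{y. norm (T y) \<le> 1}. norm y \<le> K"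
  proof (rule weakly_bounded_imp_bounded)
    fix z
    obtain x where x: "S x = z"
      using S by (metis bij_pointE)
    have "cmod (cinner z y) \<le> norm x" if "norm (T y) \<le> 1" for y
    proof -
      have "cmod (cinner z y) \<le> norm x * norm (T y)"
        using Cauchy_Schwarz[of x "T y"] adjoint_pairD[OF ST, of x y] x by simp
      also have "\<dots> \<le> norm x"
        using that by (simp add: mult_left_le)
      finally show ?thesis .
    qed
    then show "\<exists>K. \<forall>y\<in>{y. norm (T y) \<le> 1}. cmod (cinner z y) \<le> K"
      by (intro exI[of _ "norm x"]) auto
  qed
  then obtain K where K: "\<And>y. norm (T y) \<le> 1 \<Longrightarrow> norm y \<le> K"
    by auto
  have below: "norm y \<le> K * norm (T y)" for y
  proof (cases "y = 0")
    case False
    then have Ty: "T y \<noteq> 0"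
      using T0 by blast
    have "norm (inverse (norm (T y)) *\<^sub>R y) \<le> K"
      by (rule K) (use Ty in \<open>simp add: lin\<close>)
    then show ?thesis
      using Ty by (simp add: field_simps)
  qed (simp add: lin)
  have "bounded_linear T"
    using adjoint_pair_bounded_clinear[OF adjoint_pair_sym[OF ST]] by (simp add: bounded_clinear_def)
  moreover have "1 / (\<bar>K\<bar> + 1) * norm y \<le> norm (T y)" for y
  proof -
    have "K * norm (T y) \<le> (\<bar>K\<bar> + 1) * norm (T y)"
      by (intro mult_right_mono) auto
    then have "norm y \<le> (\<bar>K\<bar> + 1) * norm (T y)"
      using below[of y] by linarith
    then show ?thesis
      by (simp add: field_simps)
  qed
  ultimately have "complete (range T)"
    by (intro complete_isometric_image[of "1 / (\<bar>K\<bar> + 1)"]) (auto simp: complete_UNIV)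
  then have closed: "closed (range T)"
    by (rule complete_imp_closed)
  have sub: "csubspace (range T)"
    by (rule csubspace_range[OF adjoint_pair_sym[OF ST]])
  have "z \<in> range T" for z
  proof -
    obtain m where m: "m \<in> range T" "\<And>y. cinner (z - m) (T y) = 0"
      using orthogonal_decomposition[OF sub closed, of z] by auto
    have "S (z - m) = 0"
      by (rule cinner_eqI) (simp add: adjoint_pairD[OF ST] m(2))
    then have "z - m = 0"
      using S adjoint_pair_linear(4)[OF ST] by (metis bij_is_inj injD)
    then show ?thesis
      using m(1) by simp
  qed
  then show ?thesis
    using inj by (auto simp: bij_def)
qed

section \<open>EP operators\<close>

lemma orthogonal_projection:
  fixes M :: "'a::chilbert_space set"
  assumes M: "csubspace M" "closed M"
  obtains P where "adjoint_pair P P" "\<And>x. P x \<in> M" "\<And>x z. z \<in> M \<Longrightarrow> cinner (x - P x) z = 0"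
    "\<And>z. z \<in> M \<Longrightarrow> P z = z"
proof -
  obtain P where P: "\<And>x. P x \<in> M" "\<And>x z. z \<in> M \<Longrightarrow> cinner (x - P x) z = 0"
    using orthogonal_decomposition[OF M] by metis
  have "cinner (P x) y = cinner x (P y)" for x y
  proof -
    have "cinner (P x) (y - P y) = 0"
      by (metis P cinner_commute complex_cnj_zero)
    moreover have "cinner (x - P x) (P y) = 0"
      by (rule P(2)) (rule P(1))
    ultimately show ?thesis
      by (simp add: cinner_simps)
  qed
  moreover have "P z = z" if "z \<in> M" for z
  proof -
    have "cinner (z - P z) (z - P z) = 0"
      using csubspace_diff[OF M(1) that P(1)] P(2) by blast
    then show ?thesis
      by (simp add: cinner_self_eq_zero)
  qed
  ultimately show ?thesis
    using P by (intro that[of P]) (auto simp: adjoint_pair_def)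
qed

text \<open>
  The map is \<open>V = B \<circ> (B\<^sup>\<star>)\<^sup>-\<^sup>1\<close>, where \<open>B\<close> is \<open>T\<close> made bijective by adding the projection onto its
  kernel.
\<close>

lemma EP_imp_isomorphism:
  fixes T :: "'a::chilbert_space \<Rightarrow> 'a"
  assumes "EP T"
  obtains V V' where "adjoint_pair V V'" "bij V" "V \<circ> T\<^sup>\<star> = T"
proof -
  have T: "bounded_clinear T" "closed (range T)" and ker: "\<And>x. T x = 0 \<longleftrightarrow> T\<^sup>\<star> x = 0"
    using assms unfolding EP_def kernel_def by blast+
  note adj = adjoint_pair_cadjoint[OF T(1)]
  note lin = adjoint_pair_linear[OF adj]
  note lin' = adjoint_pair_linear[OF adjoint_pair_sym[OF adj]]
  have sub: "csubspace (range T)"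
    by (rule csubspace_range[OF adj])
  obtain P where P: "adjoint_pair P P" "\<And>x. P x \<in> range T"
      "\<And>x z. z \<in> range T \<Longrightarrow> cinner (x - P x) z = 0" "\<And>z. z \<in> range T \<Longrightarrow> P z = z"
    using orthogonal_projection[OF sub T(2)] by blast
  \<comment> \<open>The complement of the range of \<open>T\<close> is the kernel of \<open>T\<^sup>\<star>\<close>, which is also the kernel of \<open>T\<close>.\<close>
  have ker': "T\<^sup>\<star> (x - P x) = 0" for x
    by (rule cinner_eqI) (simp add: adjoint_pairD[OF adjoint_pair_sym[OF adj]] P(3))
  then have kerP: "T x = T (P x)" "T\<^sup>\<star> x = T\<^sup>\<star> (P x)" for x
    using ker[of "x - P x"] lin(2)[of x "P x"] lin'(2)[of x "P x"] by auto
  \<comment> \<open>On the range of \<open>T\<close> and on its complement, \<open>B\<close> acts as \<open>T\<close> and as the identity.\<close>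
  define B where "B x = T x + (x - P x)" for x
  define B' where "B' x = T\<^sup>\<star> x + (x - P x)" for x
  have BB': "adjoint_pair B B'"
    unfolding adjoint_pair_def B_def B'_def
    by (simp add: cinner_simps adjoint_pairD[OF adj] adjoint_pairD[OF P(1)])
  have "inj B"
  proof (rule injI)
    fix x y
    assume "B x = B y"
    define z where "z = x - y"
    have Bz: "T z + (z - P z) = 0"
      using \<open>B x = B y\<close> adjoint_pair_diff[OF BB', of x y] by (simp add: z_def B_def)
    have "cinner (z - P z) (T z) = 0"
      by (rule P(3)) simp
    moreover have "z - P z = - T z"
      using Bz by (simp add: add_eq_0_iff)
    ultimately have "T z = 0"
      by (simp add: cinner_minus_left cinner_self_eq_zero)
    then have "z = P z"
      using Bz by simp
    then obtain w where "z = T w"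
      using P(2)[of z] by auto
    have "T\<^sup>\<star> z = 0"
      using ker \<open>T z = 0\<close> by blast
    then have "cinner z z = 0"
      using adjoint_pairD[OF adj, of w z] \<open>z = T w\<close> by simp
    then show "x = y"
      by (simp add: cinner_self_eq_zero z_def)
  qed
  moreover have "\<exists>y. B y = z" for z
  proof -
    obtain x where x: "T x = P z"
      using P(2)[of z] by (metis rangeE)
    have PP: "P (P y) = P y" for y
      by (intro P(2,4))
    have "B (P x + (z - P z)) = z"
      unfolding B_def using x kerP(1)[of x] kerP(1)[of z]
      by (simp add: lin adjoint_pair_linear[OF P(1)] PP)
    then show ?thesis
      by blast
  qed
  then have "surj B"
    by (metis surj_def)
  ultimately have bij: "bij B"
    by (simp add: bij_def)
  then have bij': "bij B'"
    using adjoint_pair_bij[OF BB'] by blast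
  define V where "V = B \<circ> inv B'"
  have "adjoint_pair V (inv B \<circ> B')"
    unfolding V_def
    by (intro adjoint_pair_comp BB' adjoint_pair_inv adjoint_pair_sym[OF BB'] bij bij')
  moreover have "bij V"
    unfolding V_def using bij bij' by (simp add: bij_comp bij_imp_bij_inv)
  moreover have "V \<circ> T\<^sup>\<star> = T"
  proof
    fix x
    have "inv B' (T\<^sup>\<star> x) = P x"
      by (rule inv_f_eq[OF bij_is_inj[OF bij']])
        (use P(4)[OF P(2)] kerP(2)[of x] in \<open>simp add: B'_def\<close>)
    then show "(V \<circ> T\<^sup>\<star>) x = T x"
      using P(4)[OF P(2)] kerP(1)[of x] by (simp add: V_def B_def)
  qed
  ultimately show ?thesis
    using that by blast
qed

text \<open>Taking adjoints in \<open>V \<circ> A' = A\<close> gives \<open>A \<circ> V' = A'\<close>.\<close>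

lemma factorisation_of_adjoint:
  assumes A: "adjoint_pair A A'" and V: "adjoint_pair V V'" and eq: "V \<circ> A' = A"
  shows "A' \<circ> A = A \<circ> (V' \<circ> V) \<circ> A'"
proof -
  have "adjoint_pair A (A \<circ> V')"
    using adjoint_pair_comp[OF V adjoint_pair_sym[OF A]] by (simp add: eq)
  then have A': "A' = A \<circ> V'"
    by (rule adjoint_pair_unique[OF A])
  have "A \<circ> V' \<circ> (V \<circ> A') = A' \<circ> A"
    by (simp only: eq A'[symmetric])
  then show ?thesis
    by (simp add: comp_assoc)
qed

text \<open>This holds because \<open>kernel (A' \<circ> A) = kernel A\<close>.\<close>

lemma kernel_subset_if_factorisation:
  assumes A: "adjoint_pair A A'" and R: "R 0 = 0" and eq: "A' \<circ> A = R \<circ> A'"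
  shows "kernel A' \<subseteq> kernel A"
proof
  fix x
  assume "x \<in> kernel A'"
  then have "A' (A x) = 0"
    using fun_cong[OF eq, of x] R by (simp add: kernel_def)
  then have "cinner (A x) (A x) = 0"
    by (simp add: adjoint_pairD[OF A])
  then show "x \<in> kernel A"
    by (simp add: kernel_def cinner_self_eq_zero)
qed

theorem proposition4p7:
  fixes T :: "'a::chilbert_space \<Rightarrow> 'a"
  assumes "bounded_clinear T"
    and "closed (range T)"
  shows "(EP T \<longleftrightarrow> (\<exists>V. isomorphism V \<and> T\<^sup>\<star> \<circ> T = T \<circ> V\<^sup>\<star> \<circ> V \<circ> T\<^sup>\<star>))
    \<and> (EP T \<longleftrightarrow> (\<exists>N. bounded_clinear N \<and> inj N \<and> T\<^sup>\<star> \<circ> T = T \<circ> N\<^sup>\<star> \<circ> N \<circ> T\<^sup>\<star>))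
    \<and> (EP T \<longleftrightarrow> (\<exists>S\<^sub>1 S\<^sub>2. bounded_clinear S\<^sub>1 \<and> bounded_clinear S\<^sub>2
          \<and> T\<^sup>\<star> \<circ> T = T \<circ> S\<^sub>1 \<circ> T\<^sup>\<star> \<and> T \<circ> T\<^sup>\<star> = T\<^sup>\<star> \<circ> S\<^sub>2 \<circ> T))"
    (is "(_ \<longleftrightarrow> ?iso) \<and> (_ \<longleftrightarrow> ?inj) \<and> (_ \<longleftrightarrow> ?fact)")
proof -
  note adj = adjoint_pair_cadjoint[OF assms(1)]
  note adj' = adjoint_pair_sym[OF adj]
  have T0: "T 0 = 0" "T\<^sup>\<star> 0 = 0"
    by (rule adjoint_pair_zero[OF adj], rule adjoint_pair_zero[OF adj'])
  have zero: "S 0 = 0" if "bounded_clinear S" for S :: "'a \<Rightarrow> 'a"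
    by (rule adjoint_pair_zero[OF adjoint_pair_cadjoint[OF that]])
  have EPI: "EP T" if "kernel (T\<^sup>\<star>) \<subseteq> kernel T" "kernel T \<subseteq> kernel (T\<^sup>\<star>)"
    using that assms by (auto simp: EP_def)
  have EP_imp: "?iso \<and> ?fact" if EP: "EP T"
  proof -
    obtain V V' where V: "adjoint_pair V V'" "bij V" "V \<circ> T\<^sup>\<star> = T"
      using EP_imp_isomorphism[OF EP] by blast
    have V': "bij V'"
      by (rule adjoint_pair_bij[OF V(1,2)])
    have W: "adjoint_pair (inv V) (inv V')"
      by (rule adjoint_pair_inv[OF V(1,2) V'])
    have "inv V \<circ> (V \<circ> T\<^sup>\<star>) = T\<^sup>\<star>"
      using V(2) by (simp add: fun_eq_iff inv_f_f bij_is_inj)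
    then have WT: "inv V \<circ> T = T\<^sup>\<star>"
      by (simp only: V(3))
    have bounded: "bounded_clinear (U' \<circ> U)" if "adjoint_pair U U'" for U U' :: "'a \<Rightarrow> 'a"
      by (rule adjoint_pair_bounded_clinear)
        (rule adjoint_pair_comp[OF adjoint_pair_sym[OF that] that])
    have S1: "T\<^sup>\<star> \<circ> T = T \<circ> (V' \<circ> V) \<circ> T\<^sup>\<star>"
      by (rule factorisation_of_adjoint[OF adj V(1,3)])
    have "T \<circ> T\<^sup>\<star> = T\<^sup>\<star> \<circ> (inv V' \<circ> inv V) \<circ> T"
      by (rule factorisation_of_adjoint[OF adj' W WT])
    then have ?fact
      using S1 bounded[OF V(1)] bounded[OF W] by blast
    moreover have "isomorphism V"
      using adjoint_pair_bounded_clinear[OF V(1)] V(2) by (simp add: isomorphism_def bij_def)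
    then have ?iso
      using S1 by (auto simp: cadjoint_eqI[OF V(1)] comp_assoc)
    ultimately show ?thesis
      by blast
  qed
  have iso_inj: ?inj if ?iso
    using that by (auto simp: isomorphism_def)
  have inj_EP: "EP T" if ?inj
  proof -
    obtain N where N: "bounded_clinear N" "inj N" "T\<^sup>\<star> \<circ> T = T \<circ> N\<^sup>\<star> \<circ> N \<circ> T\<^sup>\<star>"
      using \<open>?inj\<close> by blast
    note adjN = adjoint_pair_cadjoint[OF N(1)]
    \<comment> \<open>If \<open>T x = 0\<close> then \<open>\<parallel>N (T\<^sup>\<star> x)\<parallel>\<^sup>2 = \<langle>x, T (N\<^sup>\<star> (N (T\<^sup>\<star> x)))\<rangle> = \<langle>x, T\<^sup>\<star> (T x)\<rangle> = 0\<close>.\<close>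
    have "x \<in> kernel (T\<^sup>\<star>)" if "x \<in> kernel T" for x
    proof -
      define u where "u = N (T\<^sup>\<star> x)"
      have "T ((N\<^sup>\<star>) u) = 0"
        using fun_cong[OF N(3), of x] that T0 by (simp add: kernel_def u_def)
      then have "cinner u u = 0"
        using adjoint_pairD[OF adjN, of "T\<^sup>\<star> x" u] adjoint_pairD[OF adj', of x "(N\<^sup>\<star>) u"]
        by (simp add: u_def)
      then have "N (T\<^sup>\<star> x) = N 0"
        by (simp add: u_def cinner_self_eq_zero zero[OF N(1)])
      then show ?thesis
        using N(2) by (simp add: kernel_def inj_eq)
    qed
    moreover have "kernel (T\<^sup>\<star>) \<subseteq> kernel T"
      by (rule kernel_subset_if_factorisation[OF adj _ N(3)])
        (simp add: T0 zero[OF N(1)] adjoint_pair_zero[OF adjoint_pair_sym[OF adjN]])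
    ultimately show ?thesis
      by (intro EPI) auto
  qed
  have fact_EP: "EP T" if ?fact
  proof -
    obtain S\<^sub>1 S\<^sub>2 where S: "bounded_clinear S\<^sub>1" "bounded_clinear S\<^sub>2"
        "T\<^sup>\<star> \<circ> T = T \<circ> S\<^sub>1 \<circ> T\<^sup>\<star>" "T \<circ> T\<^sup>\<star> = T\<^sup>\<star> \<circ> S\<^sub>2 \<circ> T"
      using \<open>?fact\<close> by blast
    show ?thesis
    proof (rule EPI)
      show "kernel (T\<^sup>\<star>) \<subseteq> kernel T"
        by (rule kernel_subset_if_factorisation[OF adj _ S(3)]) (simp add: T0 zero[OF S(1)])
      show "kernel T \<subseteq> kernel (T\<^sup>\<star>)"
        by (rule kernel_subset_if_factorisation[OF adj' _ S(4)]) (simp add: T0 zero[OF S(2)])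
    qed
  qed
  show ?thesis
    using EP_imp iso_inj inj_EP fact_EP by blast
qed

end
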